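(* Let $S\subseteq\mathbb{R}^n$ be nonempty, closed and convex, let $I=\{1,\dots,m\}$, let $\ell,\beta\ge 0$, and let $O\subseteq\mathbb{R}^n$ be an open set containing $S$. For each $i\in I$, suppose that, on $O$, $f_i\colon\mathbb{R}^n\to(-\infty,+\infty]$ is locally Lipschitz, $g_i\colon\mathbb{R}^n\to(-\infty,+\infty]$ is differentiable with $\ell$-Lipschitz continuous gradient, and $h_i\colon\mathbb{R}^n\to\mathbb{R}$ is $\beta$-weakly convex. Put $F_i:=f_i+g_i-h_i$ and consider the multiobjective problem $\min_{x\in S}(F_1(x),\dots,F_m(x))$. Let $\bar x\in S$ and suppose that $(f,g,h)$ is locally generalized convex-concave on $S$ at $\bar x$. If $\bar x$ is a stationary point of the problem, then $\bar x$ is a local weak Pareto solution of the problem.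
   Context: $\mathbb{R}^n$ carries the usual inner product and Euclidean norm; $\mathbb{R}^m_+$ is the nonnegative orthant; sums and differences of sets are Minkowski. Here $f=(f_1,\dots,f_m)$, $g=(g_1,\dots,g_m)$, $h=(h_1,\dots,h_m)$. Normal cones: for a set $S$ and $x\in S$, the regular (Fréchet) normal cone is $\widehat N_S(x)=\{v:\limsup_{y\to x,\,y\in S,\,y\ne x}\langle v,y-x\rangle/\|y-x\|\le 0\}$, and the limiting (Mordukhovich) normal cone $N_S(x)$ is the set of $v$ for which there are $x_k\to x$ with $x_k\in S$ and $v_k\to v$ with $v_k\in\widehat N_S(x_k)$ (for convex $S$ this is the usual normal cone of convex analysis). Contingent cone: $T_S(\bar x)=\{\nu\in\mathbb{R}^n:\exists\,t_k\to0^+,\ \nu^k\to\nu\text{ with }\bar x+t_k\nu^k\in S\ \forall k\in\mathbb{N}\}$. Subdifferential: for $\varphi\colon\mathbb{R}^n\to(-\infty,+\infty]$ and $x$ with $\varphi(x)<+\infty$, the limiting (Mordukhovich) subdifferential is $\partial\varphi(x)=\{v:(v,-1)\in N_{\operatorname{epi}\varphi}(x,\varphi(x))\}$, where $\operatorname{epi}\varphi=\{(x,\alpha)\in\mathbb{R}^n\times\mathbb{R}:\alpha\ge\varphi(x)\}$. $\varphi$ is locally Lipschitz on an open set if every point of the set has a neighborhood on which $\varphi$ is finite and Lipschitz. $\varphi$ is $\beta$-weakly convex on a set $O$ if $\beta\ge0$ and $\varphi+\delta_O+\frac{\beta}{2}\|\cdot\|^2$ is convex, where $\delta_O$ is $0$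 on $O$ and $+\infty$ elsewhere. $(f,g,h)$ is locally generalized convex-concave on $S$ at $\bar x\in S$ if there exists a neighborhood $U$ of $\bar x$ such that, for any $x\in U\cap S$ and any $u_i\in\partial f_i(\bar x)$, $v_i\in\partial h_i(\bar x)$, $i\in I$, there exists $\nu\in T_S(\bar x)$ satisfying, for all $i\in I$, $$f_i(x)-f_i(\bar x)\ge\langle u_i,\nu\rangle,\quad g_i(x)-g_i(\bar x)\ge\langle\nabla g_i(\bar x),\nu\rangle,\quad h_i(\bar x)-h_i(x)\ge\langle -v_i,\nu\rangle.$$ $\bar x\in S$ is a stationary point if there exists $\lambda\in\mathbb{R}^m_+\setminus\{0\}$ with $0\in\sum_{i\in I}\lambda_i(\partial f_i(\bar x)+\nabla g_i(\bar x)-\partial h_i(\bar x))+N_S(\bar x)$. $\bar x\in S$ is a local weak Pareto solution if there is a neighborhood $U$ of $\bar x$ such that no $x\in S\cap U$ satisfies $F_i(x)<F_i(\bar x)$ for all $i\in I$. *)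

theory Defs
  imports "HOL-Analysis.Analysis"
begin

section \<open>Normal cones and the contingent cone\<close>

text \<open>If \<open>x\<close> is isolated in \<open>S\<close>, the filter is \<open>bot\<close> and the upper limit is \<open>-\<infinity>\<close>,
  so every vector is a regular normal, as it should be.\<close>

definition regular_normal_cone :: "'a::real_inner set \<Rightarrow> 'a \<Rightarrow> 'a set" where
  "regular_normal_cone S x =
     {v. Limsup (at x within S) (\<lambda>y. ereal ((v \<bullet> (y - x)) / norm (y - x))) \<le> 0}"

definition normal_cone :: "'a::real_inner set \<Rightarrow> 'a \<Rightarrow> 'a set" where
  "normal_cone S x =
     {v. \<exists>xs vs. xs \<longlonglongrightarrow> x \<and> vs \<longlonglongrightarrow> v \<and>
           (\<forall>k::nat. xs k \<in> S \<and> vs k \<in> regular_normal_cone S (xs k))}"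

definition contingent_cone :: "'a::real_normed_vector set \<Rightarrow> 'a \<Rightarrow> 'a set" where
  "contingent_cone S x =
     {\<nu>. \<exists>t \<nu>s. t \<longlonglongrightarrow> (0::real) \<and> \<nu>s \<longlonglongrightarrow> \<nu> \<and>
           (\<forall>k::nat. t k > 0 \<and> x + t k *\<^sub>R \<nu>s k \<in> S)}"

section \<open>Extended-real-valued functions\<close>

definition epi :: "('a \<Rightarrow> ereal) \<Rightarrow> ('a \<times> real) set" where
  "epi \<phi> = {(x, \<alpha>). ereal \<alpha> \<ge> \<phi> x}"

text \<open>The limiting subdifferential is empty by convention where \<open>\<phi>\<close> is not finite.\<close>

definition subdifferential :: "('a::real_inner \<Rightarrow> ereal) \<Rightarrow> 'a \<Rightarrow> 'a set" where
  "subdifferential \<phi> x =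
     {v. \<bar>\<phi> x\<bar> \<noteq> \<infinity> \<and> (v, -1) \<in> normal_cone (epi \<phi>) (x, real_of_ereal (\<phi> x))}"

definition locally_lipschitz_on :: "'a::metric_space set \<Rightarrow> ('a \<Rightarrow> ereal) \<Rightarrow> bool" where
  "locally_lipschitz_on D \<phi> \<longleftrightarrow>
     (\<forall>x\<in>D. \<exists>U L. open U \<and> x \<in> U \<and> (\<forall>y\<in>U. \<bar>\<phi> y\<bar> \<noteq> \<infinity>) \<and>
        L-lipschitz_on U (\<lambda>y. real_of_ereal (\<phi> y)))"

definition convex_ereal_fun :: "('a::real_vector \<Rightarrow> ereal) \<Rightarrow> bool" where
  "convex_ereal_fun \<phi> \<longleftrightarrow> convex (epi \<phi>)"

definition weakly_convex_on :: "real \<Rightarrow> 'a::real_normed_vector set \<Rightarrow> ('a \<Rightarrow> ereal) \<Rightarrow> bool" where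
  "weakly_convex_on \<beta> D \<phi> \<longleftrightarrow> \<beta> \<ge> 0 \<and>
     convex_ereal_fun (\<lambda>x. \<phi> x + (if x \<in> D then 0 else \<infinity>) + ereal (\<beta> / 2 * (norm x)\<^sup>2))"

text \<open>Only meaningful where \<open>\<phi>\<close> is finite near \<open>x\<close> and differentiable at \<open>x\<close>.\<close>

definition gradient :: "('a::real_inner \<Rightarrow> ereal) \<Rightarrow> 'a \<Rightarrow> 'a" where
  "gradient \<phi> x = (THE d. GDERIV (\<lambda>y. real_of_ereal (\<phi> y)) x :> d)"

text \<open>To be used on open sets \<open>D\<close>, where finiteness on \<open>D\<close> makes \<open>\<phi>\<close> finite near every point.\<close>

definition lipschitz_gradient_on :: "real \<Rightarrow> 'a::real_inner set \<Rightarrow> ('a \<Rightarrow> ereal) \<Rightarrow> bool" where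
  "lipschitz_gradient_on ell D \<phi> \<longleftrightarrow>
     (\<forall>x\<in>D. \<bar>\<phi> x\<bar> \<noteq> \<infinity> \<and> (\<lambda>y. real_of_ereal (\<phi> y)) differentiable (at x)) \<and>
     ell-lipschitz_on D (gradient \<phi>)"

section \<open>The multiobjective problem\<close>

definition locally_gen_convex_concave ::
  "'a::real_inner set \<Rightarrow> ('m \<Rightarrow> 'a \<Rightarrow> ereal) \<Rightarrow> ('m \<Rightarrow> 'a \<Rightarrow> ereal) \<Rightarrow> ('m \<Rightarrow> 'a \<Rightarrow> real) \<Rightarrow> 'a \<Rightarrow> bool"
where
  "locally_gen_convex_concave S f g h x\<^sub>0 \<longleftrightarrow>
     (\<exists>U. open U \<and> x\<^sub>0 \<in> U \<and>
       (\<forall>x \<in> U \<inter> S. \<forall>u v.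
          (\<forall>i. u i \<in> subdifferential (f i) x\<^sub>0 \<and> v i \<in> subdifferential (\<lambda>y. ereal (h i y)) x\<^sub>0) \<longrightarrow>
          (\<exists>\<nu> \<in> contingent_cone S x\<^sub>0. \<forall>i.
             f i x - f i x\<^sub>0 \<ge> ereal (u i \<bullet> \<nu>) \<and>
             g i x - g i x\<^sub>0 \<ge> ereal (gradient (g i) x\<^sub>0 \<bullet> \<nu>) \<and>
             h i x\<^sub>0 - h i x \<ge> (- v i) \<bullet> \<nu>)))"

text \<open>Addition and \<open>\<Sum>\<close> on sets are the Minkowski operations; since minus on sets
  is set difference, the Minkowski difference \<open>A - B\<close> is written \<open>A + uminus ` B\<close>.\<close>

definition stationary_point ::
  "'a::real_inner set \<Rightarrow> ('m::finite \<Rightarrow> 'a \<Rightarrow> ereal) \<Rightarrow> ('m \<Rightarrow> 'a \<Rightarrow> ereal) \<Rightarrow> ('m \<Rightarrow> 'a \<Rightarrow> real) \<Rightarrow> 'a \<Rightarrow> bool"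
where
  "stationary_point S f g h x\<^sub>0 \<longleftrightarrow> x\<^sub>0 \<in> S \<and>
     (\<exists>\<mu>::real^'m. (\<forall>i. \<mu> $ i \<ge> 0) \<and> \<mu> \<noteq> 0 \<and>
       0 \<in> (\<Sum>i\<in>UNIV. (\<lambda>z. \<mu> $ i *\<^sub>R z) `
               (subdifferential (f i) x\<^sub>0 + {gradient (g i) x\<^sub>0}
                  + uminus ` subdifferential (\<lambda>y. ereal (h i y)) x\<^sub>0))
           + normal_cone S x\<^sub>0)"

definition local_weak_pareto ::
  "'a::topological_space set \<Rightarrow> ('m \<Rightarrow> 'a \<Rightarrow> ereal) \<Rightarrow> 'a \<Rightarrow> bool" where
  "local_weak_pareto S F x\<^sub>0 \<longleftrightarrow> x\<^sub>0 \<in> S \<and>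
     (\<exists>U. open U \<and> x\<^sub>0 \<in> U \<and> \<not> (\<exists>x \<in> S \<inter> U. \<forall>i. F i x < F i x\<^sub>0))"

end

theory Submission imports Defs begin

text \<open>Stationarity at \<open>x\<^sub>0\<close> provides weights \<open>\<mu>\<close>, subgradients \<open>u i\<close>, \<open>v i\<close> and a normal
  \<open>w\<close> such that the weighted sum of the vectors \<open>u i + gradient (g i) x\<^sub>0 - v i\<close> is \<open>- w\<close>. Suppose
  that some \<open>x \<in> S\<close> near \<open>x\<^sub>0\<close> improved every objective strictly. For these particular
  subgradients, the generalized convex-concave property yields one contingent direction \<open>\<nu>\<close>, common
  to all indices, with
  \<open>F i x - F i x\<^sub>0 \<ge> (u i + gradient (g i) x\<^sub>0 - v i) \<bullet> \<nu>\<close>.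
  Weighting and summing, the left-hand side becomes negative, because some weight is positive,
  while the right-hand side becomes \<open>- (w \<bullet> \<nu>)\<close>. This is nonnegative, since on a convex set
  the limiting normals form a nonpositive angle with every contingent direction
  (\<open>inner_normal_contingent_nonpos\<close>): a contradiction.\<close>

text \<open>Along the segment from \<open>x\<close> to \<open>y\<close> the difference quotient in the definition of a
  regular normal is constant, so its upper limit at \<open>x\<close> already bounds its value at \<open>y\<close>.\<close>

lemma regular_normal_cone_convex_inner_nonpos:
  assumes "convex S" "x \<in> S" "y \<in> S" "v \<in> regular_normal_cone S x"
  shows "v \<bullet> (y - x) \<le> 0"
proof (rule ccontr)
  assume "\<not> v \<bullet> (y - x) \<le> 0"
  then have pos: "v \<bullet> (y - x) > 0" by simp
  then have n: "norm (y - x) > 0" by auto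
  define c where "c = (v \<bullet> (y - x)) / norm (y - x)"
  have "c > 0" using pos n by (simp add: c_def)
  have "Limsup (at x within S) (\<lambda>z. ereal ((v \<bullet> (z - x)) / norm (z - x))) < ereal c"
    using assms(4) \<open>c > 0\<close> by (auto simp: regular_normal_cone_def intro: le_less_trans)
  then have "\<forall>\<^sub>F z in at x within S. ereal ((v \<bullet> (z - x)) / norm (z - x)) < ereal c"
    by (rule Limsup_lessD)
  then obtain d where "d > 0"
    and d: "\<And>z. z \<in> S \<Longrightarrow> z \<noteq> x \<Longrightarrow> dist z x < d \<Longrightarrow> (v \<bullet> (z - x)) / norm (z - x) < c"
    unfolding eventually_at by auto
  define t where "t = min 1 (d / (2 * norm (y - x)))"
  have t: "0 < t" "t \<le> 1" using \<open>d > 0\<close> n by (auto simp: t_def)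
  have "t * norm (y - x) \<le> d / (2 * norm (y - x)) * norm (y - x)"
    by (rule mult_right_mono) (auto simp: t_def)
  also have "\<dots> < d" using n \<open>d > 0\<close> by simp
  finally have tn: "t * norm (y - x) < d" .
  define z where "z = x + t *\<^sub>R (y - x)"
  have "z = (1 - t) *\<^sub>R x + t *\<^sub>R y" by (simp add: z_def algebra_simps)
  then have "z \<in> S" using assms(1-3) t by (simp add: convexD)
  moreover have "z \<noteq> x" using t n by (simp add: z_def)
  moreover have "dist z x < d" using t tn by (simp add: z_def dist_norm)
  ultimately have "(v \<bullet> (z - x)) / norm (z - x) < c" by (rule d)
  moreover have "(v \<bullet> (z - x)) / norm (z - x) = c" using t by (simp add: z_def c_def)
  ultimately show False by simp
qed

text \<open>The inequality for regular normals is closed under limits in both the base point and the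
  normal, so on a convex set limiting normals are normals in the sense of convex analysis.\<close>

lemma normal_cone_convex_inner_nonpos:
  assumes "convex S" "y \<in> S" "v \<in> normal_cone S x"
  shows "v \<bullet> (y - x) \<le> 0"
proof -
  obtain xs vs where lims: "xs \<longlonglongrightarrow> x" "vs \<longlonglongrightarrow> v"
    and "\<And>k::nat. xs k \<in> S \<and> vs k \<in> regular_normal_cone S (xs k)"
    using assms(3) unfolding normal_cone_def by blast
  then have "\<And>k. vs k \<bullet> (y - xs k) \<le> 0"
    using regular_normal_cone_convex_inner_nonpos assms(1,2) by blast
  moreover have "(\<lambda>k. vs k \<bullet> (y - xs k)) \<longlonglongrightarrow> v \<bullet> (y - x)"
    by (intro tendsto_intros lims)
  ultimately show ?thesis by (auto intro: LIMSEQ_le_const2)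
qed

text \<open>A contingent direction is a limit of positive multiples of vectors \<open>y - x\<close> with
  \<open>y \<in> S\<close>, all of which satisfy the inequality of convex analysis.\<close>

lemma inner_normal_contingent_nonpos:
  assumes "convex S" "w \<in> normal_cone S x" "\<nu> \<in> contingent_cone S x"
  shows "w \<bullet> \<nu> \<le> 0"
proof -
  obtain t \<nu>s where lim: "\<nu>s \<longlonglongrightarrow> \<nu>"
    and t: "\<And>k::nat. t k > (0::real) \<and> x + t k *\<^sub>R \<nu>s k \<in> S"
    using assms(3) unfolding contingent_cone_def by blast
  have "w \<bullet> \<nu>s k \<le> 0" for k
  proof -
    have "w \<bullet> (x + t k *\<^sub>R \<nu>s k - x) \<le> 0"
      using normal_cone_convex_inner_nonpos assms(1,2) t by blast
    then show ?thesis using t[of k] by (simp add: mult_le_0_iff)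
  qed
  moreover have "(\<lambda>k. w \<bullet> \<nu>s k) \<longlonglongrightarrow> w \<bullet> \<nu>" by (intro tendsto_intros lim)
  ultimately show ?thesis by (auto intro: LIMSEQ_le_const2)
qed

lemma stationary_pointE:
  fixes f g :: "'m::finite \<Rightarrow> 'a::real_inner \<Rightarrow> ereal"
  assumes "stationary_point S f g h x\<^sub>0"
  obtains \<mu> :: "real^'m" and u v :: "'m \<Rightarrow> 'a" and w :: 'a
  where "\<And>i. \<mu> $ i \<ge> 0" and "\<mu> \<noteq> 0"
    and "\<And>i. u i \<in> subdifferential (f i) x\<^sub>0"
    and "\<And>i. v i \<in> subdifferential (\<lambda>y. ereal (h i y)) x\<^sub>0"
    and "w \<in> normal_cone S x\<^sub>0"
    and "(\<Sum>i\<in>UNIV. \<mu> $ i *\<^sub>R (u i + gradient (g i) x\<^sub>0 - v i)) = - w"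
proof -
  define A where "A = (\<lambda>i. subdifferential (f i) x\<^sub>0 + {gradient (g i) x\<^sub>0}
                  + uminus ` subdifferential (\<lambda>y. ereal (h i y)) x\<^sub>0)"
  obtain \<mu> :: "real^'m" where \<mu>: "\<And>i. \<mu> $ i \<ge> 0" "\<mu> \<noteq> 0"
    and zero: "0 \<in> (\<Sum>i\<in>UNIV. (\<lambda>z. \<mu> $ i *\<^sub>R z) ` A i) + normal_cone S x\<^sub>0"
    using assms unfolding stationary_point_def A_def by blast
  from zero obtain z w where "z \<in> (\<Sum>i\<in>UNIV. (\<lambda>z. \<mu> $ i *\<^sub>R z) ` A i)"
    and w: "w \<in> normal_cone S x\<^sub>0" and zw: "0 = z + w"
    by (rule set_plus_elim) blast
  then obtain s where s: "\<And>i. s i \<in> (\<lambda>z. \<mu> $ i *\<^sub>R z) ` A i" and z: "z = sum s UNIV"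
    by (auto simp: set_sum_alt)
  have "\<exists>a b. a \<in> subdifferential (f i) x\<^sub>0 \<and> b \<in> subdifferential (\<lambda>y. ereal (h i y)) x\<^sub>0 \<and>
          s i = \<mu> $ i *\<^sub>R (a + gradient (g i) x\<^sub>0 - b)" for i
    using s[of i] by (auto simp: A_def set_plus_def)
  then obtain u v where uv: "\<And>i. u i \<in> subdifferential (f i) x\<^sub>0"
      "\<And>i. v i \<in> subdifferential (\<lambda>y. ereal (h i y)) x\<^sub>0"
      "\<And>i. s i = \<mu> $ i *\<^sub>R (u i + gradient (g i) x\<^sub>0 - v i)"
    by metis
  have "(\<Sum>i\<in>UNIV. \<mu> $ i *\<^sub>R (u i + gradient (g i) x\<^sub>0 - v i)) = - w"
    using z zw uv(3) by (simp add: eq_neg_iff_add_eq_0)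
  with \<mu> uv(1,2) w show thesis by (rule that)
qed

text \<open>An infinite value of \<open>p\<close>, \<open>p'\<close>, \<open>q\<close> or \<open>q'\<close> would violate the strict
  inequality or one of the two lower bounds, even though \<open>\<infinity> - \<infinity> = \<infinity>\<close> on the
  extended reals. So the hypotheses are inequalities between real numbers, which can be added.\<close>

lemma strict_decrease_imp_inner_neg:
  fixes p p' q q' :: ereal and r r' a b c :: real
  assumes "p + q - ereal r < p' + q' - ereal r'"
    and "p - p' \<ge> ereal a" and "q - q' \<ge> ereal b" and "r' - r \<ge> c"
  shows "a + b + c < 0"
  using assms by (cases p; cases p'; cases q; cases q') auto

theorem theorem3p14:
  fixes S Om :: "(real ^ 'n) set"
    and f g :: "'m::finite \<Rightarrow> real ^ 'n \<Rightarrow> ereal"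
    and h :: "'m \<Rightarrow> real ^ 'n \<Rightarrow> real"
    and ell \<beta> :: real
    and x\<^sub>0 :: "real ^ 'n"
  assumes "S \<noteq> {}" and "closed S" and "convex S"
    and "ell \<ge> 0" and "\<beta> \<ge> 0"
    and "open Om" and "S \<subseteq> Om"
    and "\<And>i x. f i x \<noteq> -\<infinity>" and "\<And>i. locally_lipschitz_on Om (f i)"
    and "\<And>i x. g i x \<noteq> -\<infinity>" and "\<And>i. lipschitz_gradient_on ell Om (g i)"
    and "\<And>i. weakly_convex_on \<beta> Om (\<lambda>x. ereal (h i x))"
    and "x\<^sub>0 \<in> S"
    and "locally_gen_convex_concave S f g h x\<^sub>0"
    and "stationary_point S f g h x\<^sub>0"
  shows "local_weak_pareto S (\<lambda>i x. f i x + g i x - ereal (h i x)) x\<^sub>0"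
proof -
  obtain \<mu> u v w where \<mu>: "\<And>i. \<mu> $ i \<ge> 0" "\<mu> \<noteq> 0"
    and u: "\<And>i. u i \<in> subdifferential (f i) x\<^sub>0"
    and v: "\<And>i. v i \<in> subdifferential (\<lambda>y. ereal (h i y)) x\<^sub>0"
    and w: "w \<in> normal_cone S x\<^sub>0"
    and sum: "(\<Sum>i\<in>UNIV. \<mu> $ i *\<^sub>R (u i + gradient (g i) x\<^sub>0 - v i)) = - w"
    using stationary_pointE[OF assms(15)] by blast
  obtain U where U: "open U" "x\<^sub>0 \<in> U"
    and dir: "\<And>x. x \<in> U \<inter> S \<Longrightarrow> \<exists>\<nu> \<in> contingent_cone S x\<^sub>0. \<forall>i.
             f i x - f i x\<^sub>0 \<ge> ereal (u i \<bullet> \<nu>) \<and>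
             g i x - g i x\<^sub>0 \<ge> ereal (gradient (g i) x\<^sub>0 \<bullet> \<nu>) \<and>
             h i x\<^sub>0 - h i x \<ge> (- v i) \<bullet> \<nu>"
    using assms(14) u v unfolding locally_gen_convex_concave_def by meson
  have False if x: "x \<in> S \<inter> U"
    and less: "\<And>i. f i x + g i x - ereal (h i x) < f i x\<^sub>0 + g i x\<^sub>0 - ereal (h i x\<^sub>0)" for x
  proof -
    obtain \<nu> where \<nu>: "\<nu> \<in> contingent_cone S x\<^sub>0"
      and est: "\<And>i. f i x - f i x\<^sub>0 \<ge> ereal (u i \<bullet> \<nu>)"
        "\<And>i. g i x - g i x\<^sub>0 \<ge> ereal (gradient (g i) x\<^sub>0 \<bullet> \<nu>)"
        "\<And>i. h i x\<^sub>0 - h i x \<ge> (- v i) \<bullet> \<nu>"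
      using dir[of x] x by blast
    have neg: "(u i + gradient (g i) x\<^sub>0 - v i) \<bullet> \<nu> < 0" for i
      using strict_decrease_imp_inner_neg[OF less est]
      by (simp add: inner_add_left inner_diff_left)
    obtain j where "\<mu> $ j \<noteq> 0" using \<mu>(2) by (auto simp: vec_eq_iff)
    then have "\<mu> $ j * ((u j + gradient (g j) x\<^sub>0 - v j) \<bullet> \<nu>) < 0"
      using \<mu>(1)[of j] neg[of j] by (intro mult_pos_neg) auto
    then have "(\<Sum>i\<in>UNIV. \<mu> $ i * ((u i + gradient (g i) x\<^sub>0 - v i) \<bullet> \<nu>)) < (\<Sum>i\<in>(UNIV::'m set). 0)"
      using \<mu>(1) neg by (intro sum_strict_mono_ex1) (auto simp: mult_nonneg_nonpos less_imp_le)
    moreover have "(\<Sum>i\<in>UNIV. \<mu> $ i * ((u i + gradient (g i) x\<^sub>0 - v i) \<bullet> \<nu>)) = - (w \<bullet> \<nu>)"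
      using arg_cong[OF sum, of "\<lambda>z. z \<bullet> \<nu>"] by (simp add: inner_sum_left)
    ultimately show False
      using inner_normal_contingent_nonpos[OF assms(3) w \<nu>] by simp
  qed
  then show ?thesis
    using assms(13) U unfolding local_weak_pareto_def by blast
qed

end
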